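(* Assume that for every tall Borel $\mathscr S$-Ramsey ideal $\mathcal I$ on $\omega$ there are $X\in\mathcal I^+$ and a closed hereditary tall family $\mathcal K\subseteq\mathcal I$ with $\{H\subseteq X:\mathscr S\upharpoonright H\subseteq\mathcal K,\ H\text{ infinite}\}\subseteq\mathcal I$. Then there is no tall Borel $\mathscr S$-Ramsey ideal on $\omega$, and hence there is no tall Borel Nash--Williams ideal on $\omega$.
   Context: All ideals on $\omega$ are proper and contain all finite sets; they are viewed as subsets of $2^\omega\cong\mathcal P(\omega)$, so "Borel" and "closed" make sense. $\mathcal I^+=\mathcal P(\omega)\setminus\mathcal I$. An ideal or family of subsets of $\omega$ is tall if every infinite subset of $\omega$ has an infinite subset in it; a family is hereditary if closed under subsets. For infinite $M\subseteq\omega$, a barrier on $M$ is a family $\mathcal B$ of nonempty finite subsets of $M$ such that every infinite subset of $M$ has an initial segment in $\mathcal B$ and no member of $\mathcal B$ is a proper subset of another. $\mathcal B\upharpoonright X=\{s\in\mathcal B:s\subseteq X\}$. For a barrier $\mathcal B$ on $M$, $\mathcal I$ is $\mathcal B$-Ramsey if for every $X\in\mathcal I^+$ with $X\subseteq M$ and every colouring of $\mathcal B\upharpoonright X$ with finitely many colours there is $H\subseteq X$, $H\in\mathcal I^+$, such that the colouring is constant on $\mathcal B\upharpoonright H$. $\mathcal I$ is Nash--Williams if it is $\mathcal B$-Ramsey for every barrier $\mathcal B$. The Schreier barrier is $\mathscr S=\{s\in[\omega]^{<\omega}\setminus\{\emptyset\}:|s|=\min(s)+1\}$, a barrier on $\omega$.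 *)

theory Defs
  imports "HOL-Analysis.Analysis"
begin

definition ideal_on_omega :: "nat set set \<Rightarrow> bool" where
  "ideal_on_omega I \<longleftrightarrow>
     UNIV \<notin> I \<and> (\<forall>A. finite A \<longrightarrow> A \<in> I) \<and>
     (\<forall>A\<in>I. \<forall>B. B \<subseteq> A \<longrightarrow> B \<in> I) \<and> (\<forall>A\<in>I. \<forall>B\<in>I. A \<union> B \<in> I)"

definition tall :: "nat set set \<Rightarrow> bool" where
  "tall F \<longleftrightarrow> (\<forall>A. infinite A \<longrightarrow> (\<exists>B\<subseteq>A. infinite B \<and> B \<in> F))"

definition hereditary :: "nat set set \<Rightarrow> bool" where
  "hereditary F \<longleftrightarrow> (\<forall>A\<in>F. \<forall>B. B \<subseteq> A \<longrightarrow> B \<in> F)"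

text \<open>The copy of a family in \<open>2\<^sup>\<omega>\<close>: the type \<open>nat \<Rightarrow> bool\<close> carries the product
  topology over the discrete space \<open>bool\<close>.\<close>

definition cantor_copy :: "nat set set \<Rightarrow> (nat \<Rightarrow> bool) set" where
  "cantor_copy F = (\<lambda>A n. n \<in> A) ` F"

definition borel_family :: "nat set set \<Rightarrow> bool" where
  "borel_family F \<longleftrightarrow> cantor_copy F \<in> sets borel"

definition closed_family :: "nat set set \<Rightarrow> bool" where
  "closed_family F \<longleftrightarrow> closed (cantor_copy F)"

definition initial_segment :: "nat set \<Rightarrow> nat set \<Rightarrow> bool" where
  "initial_segment s X \<longleftrightarrow> s \<subseteq> X \<and> (\<forall>m\<in>s. \<forall>n\<in>X. n < m \<longrightarrow> n \<in> s)"

definition barrier :: "nat set \<Rightarrow> nat set set \<Rightarrow> bool" where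
  "barrier M \<B> \<longleftrightarrow>
     infinite M \<and> (\<forall>s\<in>\<B>. s \<noteq> {} \<and> finite s \<and> s \<subseteq> M) \<and>
     (\<forall>X\<subseteq>M. infinite X \<longrightarrow> (\<exists>s\<in>\<B>. initial_segment s X)) \<and>
     (\<forall>s\<in>\<B>. \<forall>t\<in>\<B>. \<not> s \<subset> t)"

definition restrict_family :: "nat set set \<Rightarrow> nat set \<Rightarrow> nat set set" where
  "restrict_family \<B> X = {s \<in> \<B>. s \<subseteq> X}"

text \<open>Used for barriers \<open>\<B>\<close> on \<open>M\<close>. Colours are natural numbers, and a finite colouring
  of \<open>\<B> \<restriction> X\<close> is a function taking finitely many values there.\<close>

definition barrier_Ramsey :: "nat set \<Rightarrow> nat set set \<Rightarrow> nat set set \<Rightarrow> bool" where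
  "barrier_Ramsey M \<B> I \<longleftrightarrow>
     (\<forall>X. X \<notin> I \<and> X \<subseteq> M \<longrightarrow>
        (\<forall>c :: nat set \<Rightarrow> nat. finite (c ` restrict_family \<B> X) \<longrightarrow>
           (\<exists>H\<subseteq>X. H \<notin> I \<and> c constant_on restrict_family \<B> H)))"

definition Nash_Williams :: "nat set set \<Rightarrow> bool" where
  "Nash_Williams I \<longleftrightarrow> (\<forall>M \<B>. barrier M \<B> \<longrightarrow> barrier_Ramsey M \<B> I)"

definition Schreier :: "nat set set" where
  "Schreier = {s. finite s \<and> s \<noteq> {} \<and> card s = Min s + 1}"

lemma barrier_Schreier: "barrier UNIV Schreier"
proof -
  have seg: "\<exists>s\<in>Schreier. initial_segment s X" if X: "infinite X" for X :: "nat set"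
  proof -
    let ?s = "enumerate X ` {..enumerate X 0}"
    have mono: "enumerate X i \<le> enumerate X j \<longleftrightarrow> i \<le> j" for i j
      using X by (simp add: enumerate_mono_le_iff)
    have inj: "inj_on (enumerate X) {..enumerate X 0}"
      by (rule inj_onI) (metis mono order_antisym order_refl)
    have "card ?s = enumerate X 0 + 1"
      by (simp add: card_image[OF inj])
    moreover have "Min ?s = enumerate X 0"
      by (rule Min_eqI) (auto simp: mono)
    ultimately have "?s \<in> Schreier"
      by (auto simp: Schreier_def)
    moreover have "initial_segment ?s X"
    proof -
      have "n \<in> ?s" if "i \<le> enumerate X 0" "n \<in> X" "n < enumerate X i" for i n
      proof -
        obtain j where j: "n = enumerate X j"
          using enumerate_Ex[OF X \<open>n \<in> X\<close>] by metis
        then have "j \<le> i"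
          using that(3) mono by (metis less_imp_le)
        then show ?thesis
          using j that(1) by auto
      qed
      then show ?thesis
        using enumerate_in_set[OF X] by (auto simp: initial_segment_def)
    qed
    ultimately show ?thesis by blast
  qed
  have "\<not> s \<subset> t" if "s \<in> Schreier" "t \<in> Schreier" for s t
  proof
    assume st: "s \<subset> t"
    then have "card s < card t"
      using that by (intro psubset_card_mono) (simp_all add: Schreier_def)
    moreover have "Min t \<le> Min s"
      using st that by (intro Min_antimono) (simp_all add: Schreier_def psubset_imp_subset)
    moreover have "card s = Min s + 1" "card t = Min t + 1"
      using that by (simp_all add: Schreier_def)
    ultimately show False
      by linarith
  qed
  with seg show ?thesis
    by (auto simp: barrier_def Schreier_def)
qed

end

theory Submission
  imports Defs
begin

text \<open>Given \<open>X\<close> and \<open>\<K>\<close> for such an ideal, colour \<open>s \<in> \<S> \<restriction> X\<close> by whether \<open>s \<in> \<K>\<close>. A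
  homogeneous positive \<open>H \<subseteq> X\<close> cannot have \<open>\<S> \<restriction> H \<subseteq> \<K>\<close>, so \<open>\<S> \<restriction> H\<close> misses \<open>\<K>\<close>; but tallness
  gives an infinite \<open>B \<subseteq> H\<close> in \<open>\<K>\<close>, whose initial segment in \<open>\<S>\<close> lies in the hereditary
  family \<open>\<K>\<close>.\<close>

lemma barrier_Ramsey_positive_restrict_subset:
  assumes I: "ideal_on_omega I" and B: "barrier M \<B>" and R: "barrier_Ramsey M \<B> I"
    and X: "X \<notin> I" "X \<subseteq> M" and K: "hereditary K" "tall K"
  obtains H where "H \<subseteq> X" "H \<notin> I" "infinite H" "restrict_family \<B> H \<subseteq> K"
proof -
  define c :: "nat set \<Rightarrow> nat" where "c s = of_bool (s \<in> K)" for s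
  have "finite (c ` restrict_family \<B> X)"
    by (rule finite_subset[of _ "{0, 1}"]) (auto simp: c_def)
  with R X obtain H where H: "H \<subseteq> X" "H \<notin> I" "c constant_on restrict_family \<B> H"
    unfolding barrier_Ramsey_def by blast
  \<comment> \<open>Finite sets lie in \<open>I\<close>, so a positive set is infinite and tallness
    of \<open>K\<close> applies to it.\<close>
  have infH: "infinite H"
    using I H(2) unfolding ideal_on_omega_def by blast
  then obtain A where A: "A \<subseteq> H" "infinite A" "A \<in> K"
    using K(2) unfolding tall_def by blast
  then have "A \<subseteq> M"
    using H(1) X(2) by blast
  then obtain s where s: "s \<in> \<B>" "initial_segment s A"
    using B A(2) unfolding barrier_def by blast
  then have "s \<subseteq> A"
    by (simp add: initial_segment_def)
  then have "s \<in> K" "s \<in> restrict_family \<B> H"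
    using K(1) A s(1) by (auto simp: hereditary_def restrict_family_def)
  \<comment> \<open>The single member \<open>s\<close> of \<open>K\<close> fixes the constant colour
    on \<open>restrict_family \<B> H\<close> as 1, the colour of membership in
    \<open>K\<close>.\<close>
  then have "restrict_family \<B> H \<subseteq> K"
    using H(3) by (auto simp: constant_on_def c_def) (metis of_bool_eq_iff)
  with H(1,2) infH show thesis
    by (rule that)
qed

theorem proposition8p10:
  assumes "\<forall>I. ideal_on_omega I \<and> tall I \<and> borel_family I \<and> barrier_Ramsey UNIV Schreier I \<longrightarrow>
             (\<exists>X K. X \<notin> I \<and> closed_family K \<and> hereditary K \<and> tall K \<and> K \<subseteq> I \<and>
                {H. H \<subseteq> X \<and> restrict_family Schreier H \<subseteq> K \<and> infinite H} \<subseteq> I)"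
  shows "(\<nexists>I. ideal_on_omega I \<and> tall I \<and> borel_family I \<and> barrier_Ramsey UNIV Schreier I) \<and>
         (\<nexists>I. ideal_on_omega I \<and> tall I \<and> borel_family I \<and> Nash_Williams I)"
proof -
  have no_Schreier_Ramsey: False
    if I: "ideal_on_omega I" "tall I" "borel_family I" "barrier_Ramsey UNIV Schreier I" for I
  proof -
    obtain X K where X: "X \<notin> I" and K: "hereditary K" "tall K"
      and sub: "{H. H \<subseteq> X \<and> restrict_family Schreier H \<subseteq> K \<and> infinite H} \<subseteq> I"
      using assms I by blast
    obtain H where "H \<subseteq> X" "H \<notin> I" "infinite H" "restrict_family Schreier H \<subseteq> K"
      using barrier_Ramsey_positive_restrict_subset[OF I(1) barrier_Schreier I(4) X subset_UNIV K] .
    with sub show False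
      by blast
  qed
  \<comment> \<open>Instantiating the Nash-Williams property at the Schreier barrier reduces the
    second claim to the first.\<close>
  moreover have "barrier_Ramsey UNIV Schreier I" if "Nash_Williams I" for I
    using that barrier_Schreier by (simp add: Nash_Williams_def)
  ultimately show ?thesis
    by blast
qed

end
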